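(* Let $w$ be a positive integer and let $m_0,m_1,\dots,m_{w-1}$ be positive integers. Then the sequence $$\left\{\prod_{k=0}^{w-1}\big(n(n+1)-k(k+1)\big)^{m_k}\right\}_{n=0}^{\infty}=\left\{\prod_{k=0}^{w-1}\big((n+k+1)(n-k)\big)^{m_k}\right\}_{n=0}^{\infty}$$ is a CZDS for the Legendre basis $\{P_n(x)\}_{n=0}^\infty$.
   Context: For a non-zero function $f$, $Z_C(f)$ denotes the number of non-real zeros of $f$ in $\mathbb{C}$, counted according to multiplicity; for the identically zero function, $Z_C(0)=0$. Let $B=\{b_k\}_{k=0}^\infty$ be a basis of $\mathbb{R}[x]$. A sequence of real numbers $\{\gamma_k\}_{k=0}^\infty$ is a complex zero decreasing sequence (CZDS) for the basis $B$ if the linear operator $L:\mathbb{R}[x]\to\mathbb{R}[x]$ determined by $L(b_k)=\gamma_k b_k$ ($k=0,1,2,\dots$) satisfies $Z_C(L(p))\le Z_C(p)$ for every real polynomial $p$. The Legendre polynomials are $$P_n(x)=\frac{(-1)^n}{2^n n!}\frac{d^n}{dx^n}\left[(1-x)^{n}(1+x)^{n}\right]\qquad(n=0,1,2,\dots),$$ i.e. the Jacobi polynomials $P_n^{(0,0)}(x)$. *)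

theory Defs
  imports Complex_Main "HOL-Computational_Algebra.Polynomial"
begin

text \<open>Since \<open>proots 0 = {#}\<close>, the zero polynomial has no non-real zeros under this definition.\<close>
definition Z_C :: "real poly \<Rightarrow> nat" where
  "Z_C p = size {# z \<in># proots (map_poly complex_of_real p). z \<notin> \<real> #}"

definition poly_basis :: "(nat \<Rightarrow> real poly) \<Rightarrow> bool" where
  "poly_basis b \<longleftrightarrow>
     inj b \<and> \<not> module.dependent smult (range b) \<and> module.span smult (range b) = UNIV"

text \<open>Because \<open>b\<close> is a basis, the linear operator \<open>L\<close> is uniquely determined by its values on \<open>b\<close>.\<close>
definition CZDS :: "(nat \<Rightarrow> real poly) \<Rightarrow> (nat \<Rightarrow> real) \<Rightarrow> bool" where
  "CZDS b \<gamma> \<longleftrightarrow> poly_basis b \<and>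
     (\<exists>L. Vector_Spaces.linear smult smult L \<and>
          (\<forall>k. L (b k) = smult (\<gamma> k) (b k)) \<and>
          (\<forall>p. Z_C (L p) \<le> Z_C p))"

definition legendre :: "nat \<Rightarrow> real poly" where
  "legendre n =
     smult ((-1) ^ n / (2 ^ n * fact n)) ((pderiv ^^ n) ([:1, -1:] ^ n * [:1, 1:] ^ n))"

end

theory Submission
  imports Defs "HOL-Computational_Algebra.Fundamental_Theorem_Algebra"
begin

text \<open>
  Write \<open>D\<close> for differentiation and \<open>W = x\<^sup>2 - 1\<close>. The Legendre polynomial \<open>P\<^sub>n\<close> is an eigenvector,
  with eigenvalue \<open>n (n + 1)\<close>, of the operator \<open>E\<^sub>0 = D W D\<close>. So the multiplier sequence is realised
  by the product of the powers \<open>(E\<^sub>0 - k (k + 1)) ^ m k\<close> over \<open>k < w\<close>, and the claim is that this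
  operator does not increase the number of non-real zeros. A single factor \<open>E\<^sub>0 - k (k + 1)\<close> with
  \<open>k > 0\<close> is not covered by Rolle's theorem. The way out is to hand derivatives from each factor
  to the next.

  Consider the Gegenbauer operators \<open>E\<^sub>a = W D\<^sup>2 + 2 (a + 1) x D\<close>. They satisfy
  \<open>D E\<^sub>a = (E\<^sub>(a\<^sub>+\<^sub>1\<^sub>) + 2 (a + 1)) D\<close>, and therefore the shifted operators
  \<open>T\<^sub>j\<^sub>,\<^sub>k = E\<^sub>j - (k (k + 1) - j (j + 1))\<close> satisfy \<open>D T\<^sub>j\<^sub>,\<^sub>k = T\<^sub>j\<^sub>+\<^sub>1\<^sub>,\<^sub>k D\<close>. On the diagonal the shift
  vanishes, and \<open>T\<^sub>j\<^sub>,\<^sub>j = E\<^sub>j = B\<^sub>j D\<close> with \<open>B\<^sub>j h = W ^ (-j) D (W ^ (j + 1) h)\<close>. As \<open>W\<close> has only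
  real zeros, Rolle's theorem shows that \<open>D\<close>, \<open>B\<^sub>j\<close> and \<open>E\<^sub>j\<close> do not increase the number of non-real
  zeros. Let \<open>Q\<^sub>j\<close> be the product of \<open>T\<^sub>j\<^sub>,\<^sub>k ^ m k\<close> over \<open>j \<le> k < w\<close>. Since \<open>m j > 0\<close>, one
  derivative can be split off the factors with \<open>k = j\<close> and moved to the right:
  \<open>Q\<^sub>j = E\<^sub>j ^ (m j - 1) B\<^sub>j Q\<^sub>j\<^sub>+\<^sub>1 D\<close>.
  Iterating this writes \<open>Q\<^sub>0\<close> as a composition of operators covered by Rolle's theorem
  (\<open>Z_C_shifted_prod_le\<close>).

  Rolle's theorem enters in the form \<open>Z_C_pderiv_le\<close>: the non-real zeros are what remains of the
  degree after the real zeros are counted with multiplicity, and differentiation lowers the degree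
  by one while losing at most one real zero.
\<close>

section \<open>Counting non-real zeros\<close>

lemma map_poly_of_real_mult:
  "map_poly complex_of_real (p * q) = map_poly complex_of_real p * map_poly complex_of_real q"
  by (rule poly_eqI) (simp add: coeff_map_poly coeff_mult)

lemma poly_map_poly_of_real:
  "poly (map_poly complex_of_real p) (of_real x) = of_real (poly p x)"
  by (induction p) (simp_all add: map_poly_pCons)

lemma Z_C_0 [simp]: "Z_C 0 = 0"
  by (simp add: Z_C_def)

lemma Z_C_linear_factor [simp]: "Z_C ([:c, 1:] * q) = Z_C q"
proof (cases "q = 0")
  case False
  have "map_poly complex_of_real q \<noteq> 0"
    using False by (simp add: map_poly_eq_0_iff)
  moreover have "map_poly complex_of_real [:c, 1:] = [:of_real c, 1:]"
    by (simp add: map_poly_pCons)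
  ultimately show ?thesis
    by (simp add: Z_C_def map_poly_of_real_mult proots_mult del: mult_pCons_left)
qed simp

lemma Z_C_linear_factor_power [simp]: "Z_C ([:c, 1:] ^ n * q) = Z_C q"
  by (induction n) (simp_all only: power_Suc power_0 mult.assoc Z_C_linear_factor mult_1_left)

text \<open>
  By the fundamental theorem of algebra the complex zeros number \<open>degree p\<close>; splitting off the real
  linear factors one by one leaves a polynomial all of whose complex zeros are non-real. For
  \<open>p = 0\<close> all three terms are \<open>0\<close>.
\<close>
lemma Z_C_plus_real_proots: "Z_C p + size (proots p) = degree p"
proof (induction p rule: poly_root_order_induct)
  case (no_roots p)
  have real: "proots p = {#}"
    using no_roots by (simp add: multiset_eqI order_root)
  have "z \<notin> \<real>" if "z \<in># proots (map_poly complex_of_real p)" for z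
  proof
    assume "z \<in> \<real>"
    then obtain x where "z = of_real x"
      by (auto elim: Reals_cases)
    moreover have "map_poly complex_of_real p \<noteq> 0"
      using that by auto
    ultimately show False
      using that no_roots[of x] by (simp add: poly_map_poly_of_real)
  qed
  then have "{#z \<in># proots (map_poly complex_of_real p). z \<notin> \<real>#}
      = proots (map_poly complex_of_real p)"
    by (simp add: filter_mset_eq_conv)
  then have "Z_C p = degree (map_poly complex_of_real p)"
    by (simp add: Z_C_def size_proots_complex)
  then show ?case
    using real by (simp add: degree_map_poly)
next
  case (root p x n)
  have "p \<noteq> 0"
    using root.hyps by auto
  then show ?case
    using root.IH
    by (simp add: proots_mult proots_power degree_mult_eq degree_power_eq)
qed simp

section \<open>Rolle's theorem with multiplicities\<close>

lemma size_proots_eq_sum_order: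
  assumes "(p :: 'a :: idom poly) \<noteq> 0"
  shows "size (proots p) = (\<Sum>x | poly p x = 0. order x p)"
  using assms by (simp add: size_multiset_overloaded_eq)

text \<open>
  One critical point is chosen in each gap between consecutive elements of \<open>S\<close>. Disjointness
  from \<open>S\<close> matters because the multiple roots in \<open>S\<close> are counted separately below.
\<close>
lemma rolle_points_between_roots:
  fixes p :: "real poly"
  assumes "finite S" and roots: "\<And>x. x \<in> S \<Longrightarrow> poly p x = 0"
  obtains T where "finite T" "T \<inter> S = {}" "card T + 1 \<ge> card S"
    "\<And>x. x \<in> T \<Longrightarrow> poly (pderiv p) x = 0"
proof -
  \<comment> \<open>the left endpoints of the gaps; the right endpoint of the gap at \<open>x\<close> is \<open>succ x\<close>\<close>
  define R where "R = S - {Max S}"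
  define succ where "succ x = Min {y \<in> S. x < y}" for x
  have succ: "succ x \<in> S" "x < succ x" "\<And>y. y \<in> S \<Longrightarrow> x < y \<Longrightarrow> succ x \<le> y" if "x \<in> R" for x
  proof -
    have "x < Max S"
      using that assms(1) by (simp add: R_def order.not_eq_order_implies_strict)
    moreover have "Max S \<in> S"
      using that assms(1) by (intro Max_in) (auto simp: R_def)
    ultimately have ne: "{y \<in> S. x < y} \<noteq> {}"
      by auto
    have "succ x \<in> {y \<in> S. x < y}"
      unfolding succ_def using assms(1) ne by (intro Min_in) auto
    then show "succ x \<in> S" "x < succ x"
      by auto
    show "succ x \<le> y" if "y \<in> S" "x < y" for y
      unfolding succ_def using assms(1) that by (intro Min_le) auto
  qed
  have "\<exists>t. x < t \<and> t < succ x \<and> poly (pderiv p) t = 0" if xR: "x \<in> R" for x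
  proof -
    obtain t where "x < t" "t < succ x"
      and t: "poly p (succ x) - poly p x = (succ x - x) * poly (pderiv p) t"
      using poly_MVT[of x "succ x" p] succ(2)[OF xR] by blast
    moreover have "poly p (succ x) = 0" "poly p x = 0"
      using roots succ(1)[OF that] that by (auto simp: R_def)
    ultimately show ?thesis
      using succ(2)[OF that] by auto
  qed
  then obtain t where t: "\<And>x. x \<in> R \<Longrightarrow> x < t x \<and> t x < succ x \<and> poly (pderiv p) (t x) = 0"
    by metis
  have RS: "R \<subseteq> S"
    by (auto simp: R_def)
  have mono: "t x < t y" if "x \<in> R" "y \<in> R" "x < y" for x y
  proof -
    have "t x < succ x"
      using t that by blast
    also have "succ x \<le> y"
      using succ(3) that RS by blast
    also have "y < t y"
      using t that by blast
    finally show ?thesis .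
  qed
  have inj: "inj_on t R"
  proof (rule inj_onI)
    fix x y assume "x \<in> R" "y \<in> R" "t x = t y"
    then show "x = y"
      using mono[of x y] mono[of y x] by (cases x y rule: linorder_cases) auto
  qed
  have "t x \<notin> S" if "x \<in> R" for x
    using t[OF that] succ(3)[OF that, of "t x"] by auto
  then have "t ` R \<inter> S = {}"
    by auto
  moreover have "card (t ` R) + 1 \<ge> card S"
    using card_image[OF inj] assms(1) by (auto simp: R_def card_Diff_singleton_if)
  moreover have "finite (t ` R)"
    using assms(1) by (simp add: R_def)
  ultimately show thesis
    using that[of "t ` R"] t by auto
qed

text \<open>
  Passing to the derivative lowers the multiplicity of each of the \<open>s\<close> distinct real roots by one,
  and the gaps between them contribute at least \<open>s - 1\<close> new roots.
\<close>
lemma size_proots_pderiv: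
  fixes p :: "real poly"
  assumes "pderiv p \<noteq> 0"
  shows "size (proots p) \<le> size (proots (pderiv p)) + 1"
proof -
  have "p \<noteq> 0"
    using assms by auto
  define S where "S = {x. poly p x = 0}"
  have "finite S"
    using \<open>p \<noteq> 0\<close> by (simp add: S_def poly_roots_finite)
  moreover have "\<And>x. x \<in> S \<Longrightarrow> poly p x = 0"
    by (simp add: S_def)
  ultimately obtain T where T: "finite T" "T \<inter> S = {}" "card T + 1 \<ge> card S"
      "\<And>x. x \<in> T \<Longrightarrow> poly (pderiv p) x = 0"
    using rolle_points_between_roots by blast
  define q where "q = pderiv p"
  have "q \<noteq> 0"
    using assms by (simp add: q_def)
  have "size (proots p) = (\<Sum>x\<in>S. Suc (order x q))"
    unfolding size_proots_eq_sum_order[OF \<open>p \<noteq> 0\<close>] S_def q_def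
    by (rule sum.cong) (simp_all add: order_pderiv[OF \<open>p \<noteq> 0\<close>])
  also have "\<dots> = (\<Sum>x\<in>S. order x q) + card S"
    by (simp add: sum_Suc)
  also have "\<dots> \<le> (\<Sum>x\<in>S. order x q) + (card T + 1)"
    using T by simp
  also have "card T \<le> (\<Sum>x\<in>T. order x q)"
  proof -
    have "(\<Sum>x\<in>T. 1) \<le> (\<Sum>x\<in>T. order x q)"
      using T(4) \<open>q \<noteq> 0\<close> by (intro sum_mono) (simp add: q_def order_gt_0_iff Suc_leI)
    then show ?thesis
      by simp
  qed
  also have "(\<Sum>x\<in>S. order x q) + ((\<Sum>x\<in>T. order x q) + 1) = (\<Sum>x\<in>S \<union> T. order x q) + 1"
    using T \<open>finite S\<close> by (subst sum.union_disjoint) auto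
  also have "(\<Sum>x\<in>S \<union> T. order x q) = (\<Sum>x\<in>(S \<union> T) \<inter> {x. poly q x = 0}. order x q)"
    using T \<open>finite S\<close> by (intro sum.mono_neutral_right) (auto simp: order_0I)
  also have "\<dots> \<le> (\<Sum>x | poly q x = 0. order x q)"
    using \<open>q \<noteq> 0\<close> by (intro sum_mono2) (auto simp: poly_roots_finite)
  also have "\<dots> = size (proots q)"
    using size_proots_eq_sum_order[OF \<open>q \<noteq> 0\<close>] by simp
  finally show ?thesis
    by (simp add: q_def)
qed

text \<open>
  A constant \<open>p\<close> has derivative \<open>0\<close>, for which \<open>Z_C\<close> is \<open>0\<close> by convention.
\<close>
lemma Z_C_pderiv_le: "Z_C (pderiv p) \<le> Z_C p"
proof (cases "pderiv p = 0")
  case False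
  then have "degree p \<noteq> 0"
    by (simp add: pderiv_eq_0_iff)
  then show ?thesis
    using size_proots_pderiv[OF False] Z_C_plus_real_proots[of p] Z_C_plus_real_proots[of "pderiv p"]
    by (simp add: degree_pderiv)
qed simp

section \<open>Gegenbauer operators\<close>

definition weight :: "real poly" where
  "weight = [:-1, 0, 1:]"

lemma poly_weight [simp]: "poly weight x = x * x - 1"
  by (simp add: weight_def)

lemma pderiv_weight [simp]: "pderiv weight = [:0, 2:]"
  by (simp add: weight_def pderiv_pCons)

text \<open>
  For \<open>a > -1\<close> this is, up to sign, the differential operator whose eigenvectors are the polynomials
  orthogonal for the weight \<open>(1 - x\<^sup>2) ^ a\<close> on \<open>[-1, 1]\<close>; \<open>a = 0\<close> is the Legendre case. The parameter
  is real so that it may also be negative, as the Rodrigues formula requires.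
\<close>
definition gegenbauer_op :: "real \<Rightarrow> real poly \<Rightarrow> real poly" where
  "gegenbauer_op a g = weight * pderiv (pderiv g) + smult (2 * (a + 1)) ([:0, 1:] * pderiv g)"

lemma pderiv_gegenbauer_op:
  "pderiv (gegenbauer_op a g) = gegenbauer_op (a + 1) (pderiv g) + smult (2 * (a + 1)) (pderiv g)"
  unfolding poly_eq_poly_eq_iff[symmetric] gegenbauer_op_def
  by (rule ext) (simp add: pderiv_add pderiv_mult pderiv_smult pderiv_pCons algebra_simps)

lemma gegenbauer_op_add: "gegenbauer_op a (f + g) = gegenbauer_op a f + gegenbauer_op a g"
  by (simp add: gegenbauer_op_def pderiv_add algebra_simps smult_add_right)

lemma gegenbauer_op_smult: "gegenbauer_op a (smult c g) = smult c (gegenbauer_op a g)"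
  by (simp add: gegenbauer_op_def pderiv_smult smult_add_right mult.commute)

lemma Z_C_weight_power_mult: "Z_C (weight ^ n * q) = Z_C q"
proof -
  have weight_factors: "weight = [:-1, 1:] * [:1, 1:]"
    by (simp add: weight_def)
  have "weight ^ n * q = [:-1, 1:] ^ n * ([:1, 1:] ^ n * q)"
    unfolding weight_factors power_mult_distrib mult.assoc ..
  then show ?thesis
    by (simp only: Z_C_linear_factor_power)
qed

text \<open>
  This is \<open>h \<mapsto> weight ^ (-j) * pderiv (weight ^ (j + 1) * h)\<close> with the division carried out.
\<close>
definition weighted_deriv :: "nat \<Rightarrow> real poly \<Rightarrow> real poly" where
  "weighted_deriv j h = weight * pderiv h + smult (2 * (real j + 1)) ([:0, 1:] * h)"

lemma weight_power_weighted_deriv: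
  "weight ^ j * weighted_deriv j h = pderiv (weight ^ Suc j * h)"
  unfolding pderiv_mult pderiv_power_Suc weighted_deriv_def poly_eq_poly_eq_iff[symmetric]
  by (rule ext) (simp add: pderiv_pCons algebra_simps)

lemma Z_C_weighted_deriv_le: "Z_C (weighted_deriv j h) \<le> Z_C h"
  by (metis Z_C_pderiv_le Z_C_weight_power_mult weight_power_weighted_deriv)

lemma gegenbauer_op_eq_weighted_deriv: "gegenbauer_op (real j) g = weighted_deriv j (pderiv g)"
  by (simp add: gegenbauer_op_def weighted_deriv_def)

lemma Z_C_gegenbauer_op_le: "Z_C (gegenbauer_op (real j) g) \<le> Z_C g"
  unfolding gegenbauer_op_eq_weighted_deriv
  using Z_C_weighted_deriv_le Z_C_pderiv_le le_trans by blast

section \<open>Products of shifted Gegenbauer operators\<close>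

text \<open>
  The shift is chosen so that differentiation raises \<open>j\<close> and keeps \<open>k\<close>: by \<open>pderiv_gegenbauer_op\<close> it
  must decrease by \<open>2 (j + 1)\<close> when \<open>j\<close> increases by one, and for \<open>j = 0\<close> it is the Legendre
  eigenvalue \<open>k (k + 1)\<close>.
\<close>
definition shifted_op :: "nat \<Rightarrow> nat \<Rightarrow> real poly \<Rightarrow> real poly" where
  "shifted_op j k g =
     gegenbauer_op (real j) g - smult (real k * (real k + 1) - real j * (real j + 1)) g"

definition shifted_prod :: "(nat \<Rightarrow> nat) \<Rightarrow> nat \<Rightarrow> nat list \<Rightarrow> real poly \<Rightarrow> real poly" where
  "shifted_prod m j ks = foldr (\<lambda>k. shifted_op j k ^^ m k) ks"

lemma shifted_prod_Nil [simp]: "shifted_prod m j [] p = p"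
  by (simp add: shifted_prod_def)

lemma shifted_prod_Cons [simp]:
  "shifted_prod m j (k # ks) p = (shifted_op j k ^^ m k) (shifted_prod m j ks p)"
  by (simp add: shifted_prod_def)

lemma pderiv_shifted_op: "pderiv (shifted_op j k g) = shifted_op (Suc j) k (pderiv g)"
  unfolding shifted_op_def pderiv_diff pderiv_gegenbauer_op pderiv_smult poly_eq_poly_eq_iff[symmetric]
  by (rule ext) (simp add: algebra_simps)

lemma pderiv_shifted_op_power:
  "pderiv ((shifted_op j k ^^ n) g) = (shifted_op (Suc j) k ^^ n) (pderiv g)"
  by (induction n) (simp_all add: pderiv_shifted_op)

lemma pderiv_shifted_prod:
  "pderiv (shifted_prod m j ks g) = shifted_prod m (Suc j) ks (pderiv g)"
  by (induction ks) (simp_all add: pderiv_shifted_op_power)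

lemma shifted_op_self: "shifted_op j j = gegenbauer_op (real j)"
  by (simp add: shifted_op_def fun_eq_iff)

lemma Z_C_gegenbauer_op_power_le: "Z_C ((gegenbauer_op (real j) ^^ n) g) \<le> Z_C g"
  by (induction n) (auto intro: order_trans[OF Z_C_gegenbauer_op_le])

text \<open>
  The multiplicity of \<open>k = j\<close> being positive, one factor \<open>gegenbauer_op j\<close> is available to supply the
  derivative that turns the remaining factors from level \<open>j\<close> into level \<open>j + 1\<close>, where the next
  factor in turn has shift zero. If some \<open>k\<close> below \<open>w\<close> were skipped, the larger ones would never
  reach the diagonal.
\<close>
lemma Z_C_shifted_prod_le:
  assumes "\<And>k. k < w \<Longrightarrow> m k > 0"
  shows "Z_C (shifted_prod m j [j..<w] p) \<le> Z_C p"
proof (induction "w - j" arbitrary: j p)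
  case (Suc n)
  then have "j < w"
    by simp
  then obtain r where r: "m j = Suc r"
    using assms gr0_implies_Suc by blast
  let ?q = "shifted_prod m j [Suc j..<w] p"
  have "shifted_prod m j [j..<w] p = (gegenbauer_op (real j) ^^ Suc r) ?q"
    by (simp only: upt_conv_Cons[OF \<open>j < w\<close>] shifted_prod_Cons r shifted_op_self)
  also have "\<dots> = (gegenbauer_op (real j) ^^ r) (weighted_deriv j (pderiv ?q))"
    by (simp only: funpow_Suc_right o_apply gegenbauer_op_eq_weighted_deriv)
  also have "Z_C \<dots> \<le> Z_C (pderiv ?q)"
    using Z_C_gegenbauer_op_power_le Z_C_weighted_deriv_le le_trans by blast
  also have "\<dots> \<le> Z_C (pderiv p)"
    unfolding pderiv_shifted_prod using Suc by simp
  also have "\<dots> \<le> Z_C p"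
    by (rule Z_C_pderiv_le)
  finally show ?case .
qed simp

lemma shifted_op_add: "shifted_op j k (f + g) = shifted_op j k f + shifted_op j k g"
  by (simp add: shifted_op_def gegenbauer_op_add smult_add_right)

lemma shifted_op_smult: "shifted_op j k (smult c g) = smult c (shifted_op j k g)"
  by (simp add: shifted_op_def gegenbauer_op_smult smult_diff_right mult.commute)

lemma shifted_prod_add: "shifted_prod m j ks (f + g) = shifted_prod m j ks f + shifted_prod m j ks g"
proof (induction ks)
  case (Cons k ks)
  have "(shifted_op j k ^^ n) (f + g) = (shifted_op j k ^^ n) f + (shifted_op j k ^^ n) g" for n f g
    by (induction n) (simp_all add: shifted_op_add)
  then show ?case
    using Cons by simp
qed simp

lemma shifted_prod_smult: "shifted_prod m j ks (smult c g) = smult c (shifted_prod m j ks g)"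
proof (induction ks)
  case (Cons k ks)
  have "(shifted_op j k ^^ n) (smult c g) = smult c ((shifted_op j k ^^ n) g)" for n g
    by (induction n) (simp_all add: shifted_op_smult)
  then show ?case
    using Cons by simp
qed simp

lemma shifted_prod_eigenvector:
  assumes "gegenbauer_op (real j) g = smult (\<mu> - real j * (real j + 1)) g"
  shows "shifted_prod m j ks g = smult (\<Prod>k\<leftarrow>ks. (\<mu> - real k * (real k + 1)) ^ m k) g"
proof (induction ks)
  case (Cons k ks)
  have *: "shifted_op j k g = smult (\<mu> - real k * (real k + 1)) g"
    by (simp add: shifted_op_def assms flip: smult_diff_left)
  have "(shifted_op j k ^^ n) (smult c g) = smult ((\<mu> - real k * (real k + 1)) ^ n * c) g" for n c
    by (induction n) (simp_all add: shifted_op_smult * mult_ac)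
  then show ?case
    using Cons by simp
qed simp

section \<open>Legendre polynomials\<close>

text \<open>
  The added constant is the sum of \<open>2 (a + i + 1)\<close> over \<open>i < n\<close>, collected by applying
  \<open>pderiv_gegenbauer_op\<close> \<open>n\<close> times.
\<close>
lemma higher_pderiv_gegenbauer_op:
  "(pderiv ^^ n) (gegenbauer_op a g) = gegenbauer_op (a + real n) ((pderiv ^^ n) g)
     + smult (real n * (2 * a + real n + 1)) ((pderiv ^^ n) g)"
proof (induction n)
  case (Suc n)
  show ?case
    unfolding funpow.simps o_def Suc pderiv_add pderiv_gegenbauer_op pderiv_smult
    unfolding poly_eq_poly_eq_iff[symmetric]
    by (rule ext) (simp add: algebra_simps)
qed simp

text \<open>
  Differentiating the first-order equation \<open>(x\<^sup>2 - 1) u' = 2 n x u\<close> of \<open>u = (x\<^sup>2 - 1) ^ n\<close> gives a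
  second-order equation for \<open>u\<close>, which is the Gegenbauer equation with parameter \<open>-n\<close>. Then \<open>n\<close>
  further derivatives raise the parameter to \<open>0\<close> and turn \<open>u\<close> into a multiple of the Legendre
  polynomial.
\<close>
lemma gegenbauer_op_weight_power:
  "gegenbauer_op (- real n) (weight ^ n) = smult (2 * real n) (weight ^ n)"
proof -
  let ?u = "weight ^ n"
  have first_order: "weight * pderiv ?u = smult (2 * real n) ([:0, 1:] * ?u)"
  proof (cases n)
    case (Suc k)
    show ?thesis
      unfolding Suc pderiv_power_Suc poly_eq_poly_eq_iff[symmetric]
      by (rule ext) (simp add: pderiv_pCons algebra_simps)
  qed simp
  have "pderiv (weight * pderiv ?u) = pderiv (smult (2 * real n) ([:0, 1:] * ?u))"
    by (simp only: first_order)
  then have *: "weight * pderiv (pderiv ?u) + pderiv ?u * [:0, 2:]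
      = smult (2 * real n) ([:0, 1:] * pderiv ?u + ?u)"
    by (simp add: pderiv_mult pderiv_smult pderiv_pCons smult_add_right add.commute)
  have "poly (gegenbauer_op (- real n) ?u) x = poly (smult (2 * real n) ?u) x" for x
    using arg_cong[OF *, of "\<lambda>p. poly p x"] unfolding gegenbauer_op_def
    by (simp add: algebra_simps smult_add_right)
  then show ?thesis
    by (simp add: poly_eq_poly_eq_iff[symmetric] fun_eq_iff)
qed

lemma legendre_eq: "legendre n = smult (1 / (2 ^ n * fact n)) ((pderiv ^^ n) (weight ^ n))"
proof -
  have "[:1, -1:] * [:1, 1:] = smult (-1) weight"
    by (simp add: weight_def)
  then have "[:1, -1:] ^ n * [:1, 1:] ^ n = smult ((-1) ^ n) (weight ^ n)"
    by (simp only: smult_power power_mult_distrib[symmetric])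
  then show ?thesis
    unfolding legendre_def by (simp add: higher_pderiv_smult flip: power_mult_distrib)
qed

lemma gegenbauer_op_legendre:
  "gegenbauer_op 0 (legendre n) = smult (real n * (real n + 1)) (legendre n)"
proof -
  let ?v = "(pderiv ^^ n) (weight ^ n)"
  have "gegenbauer_op 0 ?v = smult (real n * (real n + 1)) ?v"
    using higher_pderiv_gegenbauer_op[of n "- real n" "weight ^ n"]
    unfolding gegenbauer_op_weight_power higher_pderiv_smult
    unfolding poly_eq_poly_eq_iff[symmetric] fun_eq_iff
    by (simp add: algebra_simps)
  then show ?thesis
    by (simp add: legendre_eq gegenbauer_op_smult mult.commute)
qed

lemma degree_legendre: "degree (legendre n) = n"
  by (simp add: legendre_eq degree_higher_pderiv degree_power_eq weight_def)

lemma vector_space_smult: "vector_space (smult :: 'a :: field \<Rightarrow> 'a poly \<Rightarrow> 'a poly)"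
  by unfold_locales (simp_all add: smult_add_right smult_add_left)

text \<open>
  In a vanishing linear combination the term of largest degree has a leading coefficient that
  nothing cancels; conversely, subtracting a multiple of \<open>b n\<close> from a polynomial of degree \<open>n\<close>
  leaves smaller degree or zero. The condition on \<open>b 0\<close> is there because the zero polynomial has
  degree \<open>0\<close>.
\<close>
lemma poly_basis_degree_eq:
  assumes deg: "\<And>n. degree (b n) = n" and "b 0 \<noteq> 0"
  shows "poly_basis b"
proof -
  interpret vector_space "smult :: real \<Rightarrow> real poly \<Rightarrow> real poly"
    by (rule vector_space_smult)
  have nonzero: "b n \<noteq> 0" for n
    using deg[of n] assms(2) by (cases n) auto
  have b_degree: "b (degree v) = v" if "v \<in> range b" for v
    using that deg by auto
  have "inj b"
    by (metis deg injI)
  moreover have "independent (range b)"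
  proof
    assume "dependent (range b)"
    then obtain S u where S: "finite S" "S \<subseteq> range b" "(\<Sum>v\<in>S. smult (u v) v) = 0"
      and "\<exists>v\<in>S. u v \<noteq> 0"
      unfolding dependent_explicit by blast
    define U where "U = {v \<in> S. u v \<noteq> 0}"
    have "finite U" "U \<noteq> {}"
      using S \<open>\<exists>v\<in>S. u v \<noteq> 0\<close> by (auto simp: U_def)
    then have "Max (degree ` U) \<in> degree ` U"
      by (intro Max_in) auto
    then obtain v where "v \<in> U" and "Max (degree ` U) = degree v"
      by blast
    then have v: "v \<in> U" "\<And>v'. v' \<in> U \<Longrightarrow> degree v' \<le> degree v"
      using \<open>finite U\<close> Max_ge[of "degree ` U"] by auto
    have other: "coeff (smult (u v') v') (degree v) = 0" if "v' \<in> S - {v}" for v'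
    proof (cases "u v' = 0")
      case False
      then have "degree v' \<le> degree v"
        using v(2) that by (simp add: U_def)
      moreover have "v' \<in> range b" "v \<in> range b" "v' \<noteq> v"
        using that S(2) v(1) unfolding U_def by blast+
      then have "degree v' \<noteq> degree v"
        using b_degree by metis
      ultimately show ?thesis
        by (simp add: coeff_eq_0)
    qed simp
    have "(\<Sum>v'\<in>S. coeff (smult (u v') v') (degree v))
        = (\<Sum>v'\<in>{v}. coeff (smult (u v') v') (degree v))"
      using S(1) v(1) other by (intro sum.mono_neutral_right ballI) (simp_all add: U_def)
    then have "u v * lead_coeff v = 0"
      using arg_cong[OF S(3), of "\<lambda>p. coeff p (degree v)"] by (simp add: coeff_sum)
    then show False
      using v(1) S(2) nonzero by (auto simp: U_def)
  qed
  moreover have "p \<in> span (range b)" for p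
  proof (induction "degree p" arbitrary: p rule: less_induct)
    case less
    define n where "n = degree p"
    define c where "c = lead_coeff p / lead_coeff (b n)"
    define r where "r = p - smult c (b n)"
    have "coeff (b n) n \<noteq> 0"
      using nonzero[of n] deg[of n] by (metis leading_coeff_0_iff)
    then have lead: "coeff r n = 0"
      by (simp add: r_def c_def n_def deg)
    have "degree r \<le> n"
      unfolding r_def n_def by (intro degree_diff_le) (auto simp: deg intro: order_trans[OF degree_smult_le])
    have "r \<in> span (range b)"
    proof (cases "degree r < n")
      case True
      then show ?thesis
        using less by (simp add: n_def)
    next
      case False
      then have "r = 0"
        using lead \<open>degree r \<le> n\<close> by (metis leading_coeff_0_iff nat_less_le)
      then show ?thesis
        by (simp add: span_zero)
    qed
    moreover have "smult c (b n) \<in> span (range b)"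
      by (intro span_scale span_base) simp
    ultimately have "r + smult c (b n) \<in> span (range b)"
      by (rule span_add)
    then show ?case
      by (simp add: r_def)
  qed
  ultimately show ?thesis
    unfolding poly_basis_def by auto
qed

lemma poly_basis_legendre: "poly_basis legendre"
proof (rule poly_basis_degree_eq)
  show "legendre 0 \<noteq> 0"
    by (simp add: legendre_def)
qed (rule degree_legendre)

theorem corollary15:
  fixes w :: nat and m :: "nat \<Rightarrow> nat"
  assumes "w > 0" and "\<And>k. k < w \<Longrightarrow> m k > 0"
  shows "(\<lambda>n. \<Prod>k<w. (real n * (real n + 1) - real k * (real k + 1)) ^ m k) =
         (\<lambda>n. \<Prod>k<w. ((real n + real k + 1) * (real n - real k)) ^ m k) \<and>
         CZDS legendre (\<lambda>n. \<Prod>k<w. (real n * (real n + 1) - real k * (real k + 1)) ^ m k)"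
proof
  show "(\<lambda>n. \<Prod>k<w. (real n * (real n + 1) - real k * (real k + 1)) ^ m k) =
        (\<lambda>n. \<Prod>k<w. ((real n + real k + 1) * (real n - real k)) ^ m k)"
    by (intro ext prod.cong refl arg_cong[of _ _ "\<lambda>t. t ^ _"]) (simp add: algebra_simps)
  let ?L = "shifted_prod m 0 [0..<w]"
  have "Vector_Spaces.linear smult smult ?L"
    by (simp add: Vector_Spaces.linear_iff vector_space_smult shifted_prod_add shifted_prod_smult)
  moreover have "?L (legendre n) =
      smult (\<Prod>k<w. (real n * (real n + 1) - real k * (real k + 1)) ^ m k) (legendre n)" for n
    using shifted_prod_eigenvector[of 0 "legendre n" "real n * (real n + 1)" m "[0..<w]"]
    by (simp add: gegenbauer_op_legendre interv_sum_list_conv_sum_set_nat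
        flip: prod.distinct_set_conv_list lessThan_atLeast0)
  moreover have "Z_C (?L p) \<le> Z_C p" for p
    using Z_C_shifted_prod_le assms(2) by blast
  ultimately show "CZDS legendre
      (\<lambda>n. \<Prod>k<w. (real n * (real n + 1) - real k * (real k + 1)) ^ m k)"
    unfolding CZDS_def using poly_basis_legendre by blast
qed

end
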